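(* Let $P$ and $Q$ be Borel probability measures on $\mathbb{R}^d$ with finite second moments, and assume that $Q$ has a positive density in the interior of its convex support. Let $\Phi$ be the set of pairs $(\varphi,\psi)\in L_1(P)\times L_1(Q)$ with $\varphi(x)+\psi(y)\ge x\cdot y$ for all $x,y\in\mathbb{R}^d$, and let $J(\varphi,\psi)=\int_{\mathbb{R}^d}\varphi\,dP+\int_{\mathbb{R}^d}\psi\,dQ$. If $\psi_1,\psi_2$ are proper, lower semicontinuous, convex functions on $\mathbb{R}^d$ such that $$J(\psi_1^*,\psi_1)=J(\psi_2^*,\psi_2)=\min_{(\varphi,\psi)\in\Phi}J(\varphi,\psi),$$ then there exists $C\in\mathbb{R}$ such that $\psi_2=\psi_1+C$ in the interior of the support of $Q$. In particular, $\psi_2=\psi_1+C$ $Q$-almost surely.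
   Context: Convex functions on $\mathbb{R}^d$ take values in $(-\infty,+\infty]$; proper means not identically $+\infty$. For a function $h$, $h^*(x)=\sup_{y\in\mathbb{R}^d}(x\cdot y-h(y))$ is its convex conjugate. The pairs $(\psi_i^*,\psi_i)$, $i=1,2$, are elements of $\Phi$, i.e. minimizers of $J$ over $\Phi$. "$Q$ has a positive density in the interior of its convex support" means that $Q$ is absolutely continuous with respect to Lebesgue measure on $\mathbb{R}^d$, with a density that is strictly positive on the interior of the convex support of $Q$ (the smallest closed convex set of full $Q$-measure); in this case the support and the convex support of $Q$ coincide. *)

theory Defs
  imports "HOL-Probability.Probability"
begin

definition proper_fun :: "('a \<Rightarrow> ereal) \<Rightarrow> bool" where
  "proper_fun h \<longleftrightarrow> (\<forall>x. h x \<noteq> - \<infinity>) \<and> (\<exists>x. h x \<noteq> \<infinity>)"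

text \<open>The library's \<open>convex_on\<close> is for real-valued functions. With \<open>h > -\<infinity>\<close> the right-hand side is
  unambiguous; for \<open>t \<in> {0, 1}\<close> the convention \<open>0 * \<infinity> = 0\<close> of \<open>ereal\<close> makes the inequality trivial.\<close>

definition convex_fun :: "('a::real_vector \<Rightarrow> ereal) \<Rightarrow> bool" where
  "convex_fun h \<longleftrightarrow> (\<forall>x. h x \<noteq> - \<infinity>) \<and>
     (\<forall>x y. \<forall>t\<in>{0..1}. h ((1 - t) *\<^sub>R x + t *\<^sub>R y) \<le> ereal (1 - t) * h x + ereal t * h y)"

definition lsc_fun :: "('a::topological_space \<Rightarrow> ereal) \<Rightarrow> bool" where
  "lsc_fun h \<longleftrightarrow> (\<forall>x. h x \<le> Liminf (at x) h)"

definition convex_conj :: "('a::real_inner \<Rightarrow> ereal) \<Rightarrow> 'a \<Rightarrow> ereal" where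
  "convex_conj h x = (SUP y. ereal (x \<bullet> y) - h y)"

text \<open>Elements of \<open>L\<^sub>1\<close> are honest functions with values in \<open>(-\<infinity>, \<infinity>]\<close>, since the constraint defining
  the dual feasible set is imposed at every point. Integrability makes the value \<open>\<infinity>\<close> occur only
  on a null set, so that the integral may be computed through \<open>real_of_ereal\<close> (which sends \<open>\<infinity>\<close> to \<open>0\<close>).\<close>

definition L1_ext :: "'a measure \<Rightarrow> ('a \<Rightarrow> ereal) set" where
  "L1_ext M = {f. f \<in> borel_measurable M \<and> (\<forall>x. f x \<noteq> - \<infinity>) \<and> (AE x in M. f x \<noteq> \<infinity>) \<and>
     integrable M (\<lambda>x. real_of_ereal (f x))}"

definition integral_ext :: "'a measure \<Rightarrow> ('a \<Rightarrow> ereal) \<Rightarrow> real" where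
  "integral_ext M f = (LINT x|M. real_of_ereal (f x))"

definition dual_feasible ::
    "'a::real_inner measure \<Rightarrow> 'a measure \<Rightarrow> (('a \<Rightarrow> ereal) \<times> ('a \<Rightarrow> ereal)) set" where
  "dual_feasible P Q = {(\<phi>, \<psi>). \<phi> \<in> L1_ext P \<and> \<psi> \<in> L1_ext Q \<and>
     (\<forall>x y. \<phi> x + \<psi> y \<ge> ereal (x \<bullet> y))}"

definition dual_cost ::
    "'a measure \<Rightarrow> 'a measure \<Rightarrow> ('a \<Rightarrow> ereal) \<times> ('a \<Rightarrow> ereal) \<Rightarrow> real" where
  "dual_cost P Q = (\<lambda>(\<phi>, \<psi>). integral_ext P \<phi> + integral_ext Q \<psi>)"

text \<open>For a Borel probability measure on a Euclidean space the following intersections have full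
  measure themselves (a second countable space is hereditarily Lindelof), hence are the smallest
  closed, respectively closed convex, sets of full measure.\<close>

definition msupport :: "'a::topological_space measure \<Rightarrow> 'a set" where
  "msupport Q = \<Inter>{C. closed C \<and> measure Q C = 1}"

definition convex_msupport :: "'a::real_normed_vector measure \<Rightarrow> 'a set" where
  "convex_msupport Q = \<Inter>{C. closed C \<and> convex C \<and> measure Q C = 1}"

definition positive_density_in_convex_support :: "'a::euclidean_space measure \<Rightarrow> bool" where
  "positive_density_in_convex_support Q \<longleftrightarrow>
     (\<exists>f \<in> borel_measurable borel. Q = density lborel f \<and> (\<forall>x \<in> interior (convex_msupport Q). f x > 0))"

end

theory Submission
  imports Defs
begin

text \<open>
  Write \<open>\<phi>\<^sub>i = \<psi>\<^sub>i\<^sup>*\<close> and average: \<open>\<phi> = (\<phi>\<^sub>1 + \<phi>\<^sub>2) / 2\<close>. Averaging the two constraints gives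
  \<open>\<phi>\<^sup>* \<le> (\<psi>\<^sub>1 + \<psi>\<^sub>2) / 2\<close> at every point, and \<open>(\<phi>, \<phi>\<^sup>*)\<close> is feasible, so its cost is at least the
  minimum. That minimum is also the cost of the averaged pair \<open>(\<phi>, (\<psi>\<^sub>1 + \<psi>\<^sub>2) / 2)\<close>. Hence the
  inequality is an equality \<open>Q\<close>-almost everywhere (\<open>average_conj_eq_AE\<close>).

  Let \<open>S\<close> be the interior of the convex support of \<open>Q\<close>. Since the density is positive on \<open>S\<close>, a
  property that holds \<open>Q\<close>-almost everywhere holds on a dense subset of \<open>S\<close>. So the convex domains of
  \<open>\<psi>\<^sub>1\<close> and \<open>\<psi>\<^sub>2\<close> contain \<open>S\<close>, all the convex functions involved are continuous on \<open>S\<close>, and the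
  equality \<open>\<phi>\<^sup>* = (\<psi>\<^sub>1 + \<psi>\<^sub>2) / 2\<close> extends to the whole of \<open>S\<close>.

  At a point \<open>y\<close> of equality, an \<open>x\<close> that almost attains the supremum defining \<open>\<phi>\<^sup>*(y)\<close> almost attains
  equality in both constraints \<open>x \<bullet> y \<le> \<phi>\<^sub>i(x) + \<psi>\<^sub>i(y)\<close>: it is an approximate subgradient of \<open>\<psi>\<^sub>1\<close> and of
  \<open>\<psi>\<^sub>2\<close> at \<open>y\<close> (\<open>common_approximate_subgradient\<close>). Two functions with common approximate subgradients
  at every point of a convex open set differ by a constant: along a finely subdivided segment the
  increments of both are squeezed between the same lower and upper sums
  (\<open>common_subgradients_imp_increment_le\<close>). Finally \<open>Q(S) = 1\<close>, because the frontier of a convex set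
  is Lebesgue null.
\<close>

section \<open>Convex functions with values in the extended reals\<close>

lemma convex_fun_finite:
  assumes "convex_fun h" and "h y \<noteq> \<infinity>"
  shows "h y = ereal (real_of_ereal (h y))"
proof -
  have "h y \<noteq> - \<infinity>" using assms(1) unfolding convex_fun_def by blast
  then show ?thesis using assms(2) by (cases "h y") simp_all
qed

lemma convex_funD:
  assumes "convex_fun h" and "0 \<le> t" "t \<le> 1"
  shows "h ((1 - t) *\<^sub>R x + t *\<^sub>R y) \<le> ereal (1 - t) * h x + ereal t * h y"
  using assms unfolding convex_fun_def by (metis atLeastAtMost_iff)

lemma convex_fun_imp_convex_domain:
  assumes "convex_fun h"
  shows "convex {y. h y \<noteq> \<infinity>}"
proof (rule convexI)
  fix x y and u v :: real
  assume xy: "x \<in> {y. h y \<noteq> \<infinity>}" "y \<in> {y. h y \<noteq> \<infinity>}" and uv: "0 \<le> u" "0 \<le> v" "u + v = 1"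
  have u: "u = 1 - v" using uv by simp
  obtain a b where "h x = ereal a" "h y = ereal b"
    using convex_fun_finite[OF assms] xy by (meson mem_Collect_eq)
  moreover have "h (u *\<^sub>R x + v *\<^sub>R y) \<le> ereal u * h x + ereal v * h y"
    using convex_funD[OF assms, of v x y] uv unfolding u by simp
  ultimately show "u *\<^sub>R x + v *\<^sub>R y \<in> {y. h y \<noteq> \<infinity>}" by auto
qed

lemma convex_fun_imp_convex_on:
  assumes h: "convex_fun h" and S: "convex S" and fin: "\<And>y. y \<in> S \<Longrightarrow> h y \<noteq> \<infinity>"
  shows "convex_on S (\<lambda>y. real_of_ereal (h y))"
proof (rule convex_onI[OF _ S])
  fix t :: real and x y assume t: "0 < t" "t < 1" and xy: "x \<in> S" "y \<in> S"
  have z: "(1 - t) *\<^sub>R x + t *\<^sub>R y \<in> S" using convexD[OF S xy, of "1 - t" t] t by simp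
  obtain a b c where "h x = ereal a" "h y = ereal b" "h ((1 - t) *\<^sub>R x + t *\<^sub>R y) = ereal c"
    using convex_fun_finite[OF h fin] xy z by meson
  moreover have "h ((1 - t) *\<^sub>R x + t *\<^sub>R y) \<le> ereal (1 - t) * h x + ereal t * h y"
    using convex_funD[OF h, of t x y] t by simp
  ultimately show "real_of_ereal (h ((1 - t) *\<^sub>R x + t *\<^sub>R y))
      \<le> (1 - t) * real_of_ereal (h x) + t * real_of_ereal (h y)"
    by simp
qed

text \<open>Density suffices because a convex set and its closure have the same interior.\<close>

lemma dense_convex_domain_imp_finite:
  fixes h :: "'a::euclidean_space \<Rightarrow> ereal"
  assumes "convex_fun h" and "open S" and "S \<subseteq> closure {y \<in> S. h y \<noteq> \<infinity>}" and "y \<in> S"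
  shows "h y \<noteq> \<infinity>"
proof -
  have "closure {y \<in> S. h y \<noteq> \<infinity>} \<subseteq> closure {y. h y \<noteq> \<infinity>}"
    by (rule closure_mono) blast
  with assms(3) have "S \<subseteq> closure {y. h y \<noteq> \<infinity>}" by (rule subset_trans)
  then have "S \<subseteq> interior (closure {y. h y \<noteq> \<infinity>})" using assms(2) by (simp add: interior_maximal)
  also have "\<dots> \<subseteq> {y. h y \<noteq> \<infinity>}"
    unfolding convex_interior_closure[OF convex_fun_imp_convex_domain[OF assms(1)]]
    by (rule interior_subset)
  finally show ?thesis using assms(4) by auto
qed

section \<open>Convex conjugates\<close>

lemma convex_conj_upper: "ereal (x \<bullet> y) - h x \<le> convex_conj h y"
  unfolding convex_conj_def by (rule SUP_upper2[of x]) (simp_all add: inner_commute)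

lemma convex_conj_not_MInfty:
  assumes "proper_fun h"
  shows "convex_conj h y \<noteq> - \<infinity>"
proof -
  obtain x where "h x \<noteq> \<infinity>" "h x \<noteq> - \<infinity>" using assms unfolding proper_fun_def by auto
  then obtain r where "h x = ereal r" by (cases "h x") auto
  then show ?thesis using convex_conj_upper[of x y h] by auto
qed

lemma convex_fun_convex_conj:
  assumes "proper_fun h"
  shows "convex_fun (convex_conj h)"
  unfolding convex_fun_def
proof (intro conjI allI ballI)
  fix y z and t :: real assume t: "t \<in> {0..1}"
  show "convex_conj h ((1 - t) *\<^sub>R y + t *\<^sub>R z)
      \<le> ereal (1 - t) * convex_conj h y + ereal t * convex_conj h z"
    unfolding convex_conj_def[of h "(1 - t) *\<^sub>R y + t *\<^sub>R z"]
  proof (rule SUP_least)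
    fix x
    show "ereal (((1 - t) *\<^sub>R y + t *\<^sub>R z) \<bullet> x) - h x
        \<le> ereal (1 - t) * convex_conj h y + ereal t * convex_conj h z"
    proof (cases "h x")
      case (real r)
      have "ereal (((1 - t) *\<^sub>R y + t *\<^sub>R z) \<bullet> x) - h x
          = ereal (1 - t) * (ereal (x \<bullet> y) - h x) + ereal t * (ereal (x \<bullet> z) - h x)"
        using real by (simp add: inner_add_left inner_add_right inner_commute algebra_simps)
      also have "\<dots> \<le> ereal (1 - t) * convex_conj h y + ereal t * convex_conj h z"
        using t by (intro add_mono ereal_mult_left_mono convex_conj_upper) auto
      finally show ?thesis .
    qed (use assms in \<open>auto simp: proper_fun_def\<close>)
  qed
qed (use convex_conj_not_MInfty[OF assms] in auto)

text \<open>A conjugate is a supremum of continuous functions, so its strict superlevel sets are open.\<close>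

lemma borel_measurable_convex_conj:
  fixes h :: "'a::euclidean_space \<Rightarrow> ereal"
  shows "convex_conj h \<in> borel_measurable borel"
proof (rule borel_measurableI_greater)
  fix a :: ereal
  have "open (\<Union>x. {y. a < ereal (y \<bullet> x) - h x})"
  proof (intro open_UN ballI)
    fix x
    show "open {y. a < ereal (y \<bullet> x) - h x}"
    proof (cases "h x")
      case (real r)
      have "open {y. a < ereal (y \<bullet> x - r)}"
        by (intro open_Collect_less continuous_intros)
      then show ?thesis using real by simp
    qed auto
  qed
  moreover have "{y \<in> space borel. a < convex_conj h y} = (\<Union>x. {y. a < ereal (y \<bullet> x) - h x})"
    unfolding convex_conj_def by (auto simp: less_SUP_iff)
  ultimately show "{y \<in> space borel. a < convex_conj h y} \<in> sets borel" by simp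
qed

section \<open>Averaging two minimizers of the dual problem\<close>

lemma L1_ext_average:
  assumes "f \<in> L1_ext M" "g \<in> L1_ext M"
  shows "(\<lambda>x. (f x + g x) / 2) \<in> L1_ext M"
    and "integral_ext M (\<lambda>x. (f x + g x) / 2) = (integral_ext M f + integral_ext M g) / 2"
proof -
  have m: "f \<in> borel_measurable M" "g \<in> borel_measurable M"
    and i: "integrable M (\<lambda>x. real_of_ereal (f x))" "integrable M (\<lambda>x. real_of_ereal (g x))"
    and n: "f x \<noteq> - \<infinity>" "g x \<noteq> - \<infinity>"
    and fin: "AE x in M. f x \<noteq> \<infinity>" "AE x in M. g x \<noteq> \<infinity>" for x
    using assms unfolding L1_ext_def by auto
  have av: "AE x in M. real_of_ereal ((f x + g x) / 2) = (real_of_ereal (f x) + real_of_ereal (g x)) / 2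
      \<and> (f x + g x) / 2 \<noteq> \<infinity>"
    using fin
  proof eventually_elim
    case (elim x)
    then show ?case using n[of x] by (cases "f x"; cases "g x") auto
  qed
  have avm: "(\<lambda>x. (f x + g x) / 2) \<in> borel_measurable M" using m by measurable
  have "integrable M (\<lambda>x. real_of_ereal ((f x + g x) / 2))
      \<longleftrightarrow> integrable M (\<lambda>x. (real_of_ereal (f x) + real_of_ereal (g x)) / 2)"
    using av avm m by (intro integrable_cong_AE) auto
  moreover have "(f x + g x) / 2 \<noteq> - \<infinity>" for x using n[of x] by (cases "f x"; cases "g x") auto
  ultimately show "(\<lambda>x. (f x + g x) / 2) \<in> L1_ext M"
    unfolding L1_ext_def using i avm av by auto
  have "integral_ext M (\<lambda>x. (f x + g x) / 2)
      = (LINT x|M. (real_of_ereal (f x) + real_of_ereal (g x)) / 2)"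
    unfolding integral_ext_def using av avm m by (intro integral_cong_AE) auto
  also have "\<dots> = (integral_ext M f + integral_ext M g) / 2"
    unfolding integral_ext_def using i by simp
  finally show "integral_ext M (\<lambda>x. (f x + g x) / 2) = (integral_ext M f + integral_ext M g) / 2" .
qed

lemma convex_conj_average_le:
  assumes "\<And>x. ereal (x \<bullet> y) \<le> \<phi>1 x + \<psi>1 y" and "\<And>x. ereal (x \<bullet> y) \<le> \<phi>2 x + \<psi>2 y"
    and "\<And>x. \<phi>1 x \<noteq> - \<infinity>" and "\<And>x. \<phi>2 x \<noteq> - \<infinity>"
    and "\<psi>1 y \<noteq> - \<infinity>" and "\<psi>2 y \<noteq> - \<infinity>"
  shows "convex_conj (\<lambda>x. (\<phi>1 x + \<phi>2 x) / 2) y \<le> (\<psi>1 y + \<psi>2 y) / 2"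
  unfolding convex_conj_def
proof (rule SUP_least)
  fix x
  show "ereal (y \<bullet> x) - (\<phi>1 x + \<phi>2 x) / 2 \<le> (\<psi>1 y + \<psi>2 y) / 2"
    using assms(1,2,3,4)[of x] assms(5,6)
    by (cases "\<phi>1 x"; cases "\<phi>2 x"; cases "\<psi>1 y"; cases "\<psi>2 y") (auto simp: inner_commute field_simps)
qed

text \<open>Both \<open>(\<phi>, \<phi>\<^sup>*)\<close> and \<open>(\<phi>, (\<psi>1 + \<psi>2) / 2)\<close>, where \<open>\<phi>\<close> is the average of \<open>\<phi>1\<close> and \<open>\<phi>2\<close>, have
  minimal cost, and the second components are ordered pointwise, so they agree almost everywhere. The first moment
  of \<open>Q\<close> is what makes \<open>\<phi>\<^sup>*\<close> integrable: an affine function bounds it from below.\<close>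

lemma average_conj_eq_AE:
  fixes P Q :: "'a::euclidean_space measure"
  assumes P: "prob_space P" and Q: "prob_space Q" and sQ: "sets Q = sets borel"
    and mom: "integrable Q norm"
    and min1: "is_arg_min (dual_cost P Q) (\<lambda>p. p \<in> dual_feasible P Q) (\<phi>1, \<psi>1)"
    and min2: "is_arg_min (dual_cost P Q) (\<lambda>p. p \<in> dual_feasible P Q) (\<phi>2, \<psi>2)"
  shows "AE y in Q. convex_conj (\<lambda>x. (\<phi>1 x + \<phi>2 x) / 2) y = (\<psi>1 y + \<psi>2 y) / 2"
    and "proper_fun (\<lambda>x. (\<phi>1 x + \<phi>2 x) / 2)"
proof -
  interpret P: prob_space P by (rule P)
  interpret Q: prob_space Q by (rule Q)
  define \<phi> where "\<phi> = (\<lambda>x. (\<phi>1 x + \<phi>2 x) / 2)"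
  define \<psi> where "\<psi> = (\<lambda>y. (\<psi>1 y + \<psi>2 y) / 2)"
  have feas: "(\<phi>1, \<psi>1) \<in> dual_feasible P Q" "(\<phi>2, \<psi>2) \<in> dual_feasible P Q"
    using min1 min2 by (auto simp: is_arg_min_def)
  then have L1: "\<phi>1 \<in> L1_ext P" "\<phi>2 \<in> L1_ext P" "\<psi>1 \<in> L1_ext Q" "\<psi>2 \<in> L1_ext Q"
    and dom: "\<And>x y. ereal (x \<bullet> y) \<le> \<phi>1 x + \<psi>1 y" "\<And>x y. ereal (x \<bullet> y) \<le> \<phi>2 x + \<psi>2 y"
    unfolding dual_feasible_def by auto
  have \<phi>L: "\<phi> \<in> L1_ext P" and \<phi>i: "integral_ext P \<phi> = (integral_ext P \<phi>1 + integral_ext P \<phi>2) / 2"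
    unfolding \<phi>_def using L1_ext_average[OF L1(1,2)] by auto
  have \<psi>L: "\<psi> \<in> L1_ext Q" and \<psi>i: "integral_ext Q \<psi> = (integral_ext Q \<psi>1 + integral_ext Q \<psi>2) / 2"
    unfolding \<psi>_def using L1_ext_average[OF L1(3,4)] by auto
  have ae\<phi>: "AE x in P. \<phi> x \<noteq> \<infinity>" using \<phi>L unfolding L1_ext_def by auto
  have "\<exists>x0. \<phi> x0 \<noteq> \<infinity>"
  proof (rule ccontr)
    assume "\<not> (\<exists>x0. \<phi> x0 \<noteq> \<infinity>)"
    then have "AE x in P. False" using ae\<phi> by simp
    then show False by simp
  qed
  then obtain x0 where x0: "\<phi> x0 \<noteq> \<infinity>" by blast
  have n\<phi>: "\<phi> x \<noteq> - \<infinity>" for x using \<phi>L unfolding L1_ext_def by auto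
  show proper_avg: "proper_fun (\<lambda>x. (\<phi>1 x + \<phi>2 x) / 2)"
    using x0 n\<phi> unfolding proper_fun_def \<phi>_def by blast
  obtain r where r: "\<phi> x0 = ereal r" using x0 n\<phi>[of x0] by (cases "\<phi> x0") simp_all
  have lower: "ereal (x0 \<bullet> y - r) \<le> convex_conj \<phi> y" for y
    using convex_conj_upper[of x0 y \<phi>] r by simp
  have upper: "convex_conj \<phi> y \<le> \<psi> y" for y
    unfolding \<phi>_def \<psi>_def using dom L1 by (intro convex_conj_average_le) (auto simp: L1_ext_def)
  have fin: "AE y in Q. \<psi> y \<noteq> \<infinity>" and n\<psi>: "\<And>y. \<psi> y \<noteq> - \<infinity>"
    and int\<psi>: "integrable Q (\<lambda>y. real_of_ereal (\<psi> y))"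
    using \<psi>L unfolding L1_ext_def by auto
  have bounds: "AE y in Q. convex_conj \<phi> y \<noteq> \<infinity> \<and> x0 \<bullet> y - r \<le> real_of_ereal (convex_conj \<phi> y)
      \<and> real_of_ereal (convex_conj \<phi> y) \<le> real_of_ereal (\<psi> y)"
    using fin
  proof eventually_elim
    case (elim y)
    then show ?case
      using lower[of y] upper[of y] n\<psi>[of y] by (cases "convex_conj \<phi> y"; cases "\<psi> y") auto
  qed
  have meas: "convex_conj \<phi> \<in> borel_measurable Q"
    using borel_measurable_convex_conj sQ by (metis measurable_cong_sets)
  have id: "(\<lambda>y. y) \<in> borel_measurable Q" using sQ by (simp add: measurable_ident_sets)
  have inn: "(\<lambda>y. x0 \<bullet> y) \<in> borel_measurable Q" using id by measurable
  have intx0: "integrable Q (\<lambda>y. x0 \<bullet> y)"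
    by (rule Bochner_Integration.integrable_bound[of Q "\<lambda>y. norm x0 * norm y"])
       (use mom inn in \<open>auto simp: Cauchy_Schwarz_ineq2\<close>)
  have intc: "integrable Q (\<lambda>y. real_of_ereal (convex_conj \<phi> y))"
  proof (rule Bochner_Integration.integrable_bound)
    show "integrable Q (\<lambda>y. \<bar>x0 \<bullet> y - r\<bar> + \<bar>real_of_ereal (\<psi> y)\<bar>)"
      using intx0 int\<psi> by (intro Bochner_Integration.integrable_add integrable_abs) auto
    show "AE y in Q. norm (real_of_ereal (convex_conj \<phi> y)) \<le> norm (\<bar>x0 \<bullet> y - r\<bar> + \<bar>real_of_ereal (\<psi> y)\<bar>)"
      using bounds unfolding real_norm_def by eventually_elim (elim conjE, linarith)
  qed (use meas in simp)
  have cL: "convex_conj \<phi> \<in> L1_ext Q"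
    unfolding L1_ext_def using meas intc bounds convex_conj_not_MInfty[OF proper_avg]
    by (auto simp: \<phi>_def)
  have "ereal (x \<bullet> y) \<le> \<phi> x + convex_conj \<phi> y" for x y
    using convex_conj_upper[of x y \<phi>] n\<phi>[of x] convex_conj_not_MInfty[OF proper_avg, of y, folded \<phi>_def]
    by (cases "\<phi> x"; cases "convex_conj \<phi> y") auto
  then have "(\<phi>, convex_conj \<phi>) \<in> dual_feasible P Q"
    unfolding dual_feasible_def using \<phi>L cL by auto
  then have "dual_cost P Q (\<phi>1, \<psi>1) \<le> dual_cost P Q (\<phi>, convex_conj \<phi>)"
    "dual_cost P Q (\<phi>2, \<psi>2) \<le> dual_cost P Q (\<phi>, convex_conj \<phi>)"
    using min1 min2 unfolding is_arg_min_def by (auto simp: not_less)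
  then have "integral_ext Q \<psi> \<le> integral_ext Q (convex_conj \<phi>)"
    unfolding dual_cost_def \<phi>i \<psi>i prod.case add_divide_distrib by linarith
  moreover have "integral_ext Q (convex_conj \<phi>) \<le> integral_ext Q \<psi>"
    unfolding integral_ext_def using bounds by (intro integral_mono_AE intc int\<psi>) auto
  ultimately have "(LINT y|Q. real_of_ereal (\<psi> y) - real_of_ereal (convex_conj \<phi> y)) = 0"
    using intc int\<psi> by (simp add: integral_ext_def)
  then have "AE y in Q. real_of_ereal (\<psi> y) - real_of_ereal (convex_conj \<phi> y) = 0"
    using bounds intc int\<psi> by (subst (asm) integral_nonneg_eq_0_iff_AE) auto
  with bounds fin have "AE y in Q. convex_conj \<phi> y = \<psi> y"
  proof eventually_elim
    case (elim y)
    then show ?case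
      using lower[of y] n\<psi>[of y] by (cases "convex_conj \<phi> y"; cases "\<psi> y") auto
  qed
  then show "AE y in Q. convex_conj (\<lambda>x. (\<phi>1 x + \<phi>2 x) / 2) y = (\<psi>1 y + \<psi>2 y) / 2"
    unfolding \<phi>_def \<psi>_def .
qed

section \<open>Common approximate subgradients determine a function up to a constant\<close>

text \<open>If the two nonnegative slacks \<open>\<phi>i x + \<psi>i y - x \<bullet> y\<close> add up to less than \<open>e\<close>, each
  of them is less than \<open>e\<close>; comparing with the constraint at \<open>(x, z)\<close> turns this into the approximate
  subgradient inequality.\<close>

lemma common_approximate_subgradient:
  assumes eq: "convex_conj (\<lambda>x. (\<phi>1 x + \<phi>2 x) / 2) y = (\<psi>1 y + \<psi>2 y) / 2"
    and dom: "\<And>x z. ereal (x \<bullet> z) \<le> \<phi>1 x + \<psi>1 z" "\<And>x z. ereal (x \<bullet> z) \<le> \<phi>2 x + \<psi>2 z"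
    and fin: "\<And>z. z \<in> S \<Longrightarrow> \<psi>1 z = ereal (g1 z) \<and> \<psi>2 z = ereal (g2 z)"
    and n: "\<And>x. \<phi>1 x \<noteq> - \<infinity>" "\<And>x. \<phi>2 x \<noteq> - \<infinity>"
    and y: "y \<in> S" and e: "0 < e"
  shows "\<exists>x. \<forall>z\<in>S. g1 y + x \<bullet> (z - y) - e \<le> g1 z \<and> g2 y + x \<bullet> (z - y) - e \<le> g2 z"
proof -
  have "ereal ((g1 y + g2 y) / 2 - e / 2) < convex_conj (\<lambda>x. (\<phi>1 x + \<phi>2 x) / 2) y"
    using eq fin[OF y] e by (simp add: field_simps)
  then obtain x where x: "ereal ((g1 y + g2 y) / 2 - e / 2) < ereal (y \<bullet> x) - (\<phi>1 x + \<phi>2 x) / 2"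
    unfolding convex_conj_def by (auto simp: less_SUP_iff)
  then obtain a b where ab: "\<phi>1 x = ereal a" "\<phi>2 x = ereal b"
    using n[of x] by (cases "\<phi>1 x"; cases "\<phi>2 x") auto
  have sum: "(g1 y + g2 y) - e < 2 * (x \<bullet> y) - (a + b)"
    using x ab by (simp add: inner_commute add_divide_distrib)
  have le: "x \<bullet> z \<le> a + g1 z" "x \<bullet> z \<le> b + g2 z" if "z \<in> S" for z
    using dom[of x z] ab fin[OF that] by auto
  show ?thesis
  proof (intro exI ballI)
    fix z assume "z \<in> S"
    then show "g1 y + x \<bullet> (z - y) - e \<le> g1 z \<and> g2 y + x \<bullet> (z - y) - e \<le> g2 z"
      using sum le[OF y] le[of z] by (auto simp: inner_diff_right)
  qed
qed

text \<open>With common subgradients \<open>x\<^sub>k\<close> at equally spaced points \<open>y\<^sub>0 = a, \<dots>, y\<^sub>N = b\<close> of the segment and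
  \<open>d = b - a\<close>, both increments \<open>gi y\<^sub>k\<^sub>+\<^sub>1 - gi y\<^sub>k\<close> lie between \<open>x\<^sub>k \<bullet> d / N\<close> and \<open>x\<^sub>k\<^sub>+\<^sub>1 \<bullet> d / N\<close> up to
  an error \<open>e\<close>. The widths of these intervals telescope to \<open>(x\<^sub>N - x\<^sub>0) \<bullet> d / N\<close>, which tends to \<open>0\<close>.
  Exchanging \<open>a\<close> and \<open>b\<close> gives the reverse inequality.\<close>

lemma common_subgradients_imp_increment_le:
  fixes g1 g2 :: "'a::real_inner \<Rightarrow> real"
  assumes S: "open S" "convex S"
    and sub: "\<And>y e. y \<in> S \<Longrightarrow> 0 < e \<Longrightarrow>
      \<exists>x. \<forall>z\<in>S. g1 y + x \<bullet> (z - y) - e \<le> g1 z \<and> g2 y + x \<bullet> (z - y) - e \<le> g2 z"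
    and ab: "a \<in> S" "b \<in> S"
  shows "g1 b - g1 a \<le> g2 b - g2 a"
proof -
  define d where "d = b - a"
  \<comment> \<open>Extending the segment slightly beyond both ends bounds the end slopes \<open>x\<^sub>0 \<bullet> d\<close> and \<open>x\<^sub>N \<bullet> d\<close>
    uniformly in \<open>N\<close>, although the \<open>x\<^sub>k\<close> change with \<open>N\<close>.\<close>
  have "((\<lambda>h. a - h *\<^sub>R d) \<longlongrightarrow> a - 0 *\<^sub>R d) (at_right 0)"
    and "((\<lambda>h. b + h *\<^sub>R d) \<longlongrightarrow> b + 0 *\<^sub>R d) (at_right 0)"
    by (intro tendsto_intros)+
  then have "\<forall>\<^sub>F h in at_right 0. a - h *\<^sub>R d \<in> S" "\<forall>\<^sub>F h in at_right 0. b + h *\<^sub>R d \<in> S"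
    using topological_tendstoD[OF _ S(1)] ab by (metis diff_zero scale_zero_left, metis add_0_right scale_zero_left)
  then have "\<forall>\<^sub>F h::real in at_right 0. 0 < h \<and> a - h *\<^sub>R d \<in> S \<and> b + h *\<^sub>R d \<in> S"
    using eventually_at_right_less[of "0::real"] by eventually_elim auto
  then obtain h :: real where h: "0 < h" "a - h *\<^sub>R d \<in> S" "b + h *\<^sub>R d \<in> S"
    using eventually_happens[of _ "at_right (0::real)"] by (auto simp: trivial_limit_at_right_real)
  define B where "B = (\<bar>g1 (b + h *\<^sub>R d)\<bar> + \<bar>g1 b\<bar> + \<bar>g1 (a - h *\<^sub>R d)\<bar> + \<bar>g1 a\<bar> + 2) / h"
  have bound: "g1 b - g1 a - (g2 b - g2 a) \<le> (B + 2) / Suc n" for n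
  proof -
    define N where "N = Suc n"
    \<comment> \<open>An error \<open>2 e\<close> occurs in each of the \<open>N\<close> steps, so \<open>e\<close> has to be \<open>o(1 / N)\<close>.\<close>
    define e where "e = 1 / (real N)\<^sup>2"
    have N: "1 \<le> N" "0 < e" "e \<le> 1" unfolding e_def N_def by (auto simp: field_simps)
    define y where "y k = a + (real k / real N) *\<^sub>R d" for k
    have yS: "y k \<in> S" if "k \<le> N" for k
    proof -
      have "y k = (1 - real k / real N) *\<^sub>R a + (real k / real N) *\<^sub>R b"
        unfolding y_def d_def by (simp add: algebra_simps)
      moreover have "0 \<le> real k / real N" "real k / real N \<le> 1" using that N by auto
      ultimately show ?thesis
        using convexD[OF S(2) ab, of "1 - real k / real N" "real k / real N"] by simp
    qed
    have "\<forall>k. \<exists>x. k \<le> N \<longrightarrow> (\<forall>z\<in>S. g1 (y k) + x \<bullet> (z - y k) - e \<le> g1 z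
        \<and> g2 (y k) + x \<bullet> (z - y k) - e \<le> g2 z)"
      using sub[OF yS N(2)] by blast
    then obtain x where x: "\<And>k z. k \<le> N \<Longrightarrow> z \<in> S \<Longrightarrow> g1 (y k) + x k \<bullet> (z - y k) - e \<le> g1 z
        \<and> g2 (y k) + x k \<bullet> (z - y k) - e \<le> g2 z"
      by metis
    have y0: "y 0 = a" and yN: "y N = b" unfolding y_def d_def using N by auto
    have ydiff: "y (Suc k) - y k = (1 / real N) *\<^sub>R d" for k
      unfolding y_def by (simp flip: scaleR_diff_left diff_divide_distrib)
    have step: "(g1 (y (Suc k)) - g1 (y k)) - (g2 (y (Suc k)) - g2 (y k))
        \<le> (x (Suc k) \<bullet> d - x k \<bullet> d) / N + 2 * e" if "k < N" for k
    proof -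
      have "y k - y (Suc k) = - ((1 / real N) *\<^sub>R d)" using ydiff[of k] by (metis minus_diff_eq)
      then have "g1 (y (Suc k)) - x (Suc k) \<bullet> d / N - e \<le> g1 (y k)"
        using x[of "Suc k" "y k"] yS[of k] that by auto
      moreover have "g2 (y k) + x k \<bullet> d / N - e \<le> g2 (y (Suc k))"
        using x[of k "y (Suc k)"] yS[of "Suc k"] ydiff[of k] that by auto
      ultimately show ?thesis by (simp add: diff_divide_distrib)
    qed
    have "g1 b - g1 a - (g2 b - g2 a)
        = (\<Sum>k<N. (g1 (y (Suc k)) - g1 (y k)) - (g2 (y (Suc k)) - g2 (y k)))"
      using sum_lessThan_telescope[of "\<lambda>k. g1 (y k) - g2 (y k)" N] by (simp add: y0 yN algebra_simps)
    also have "\<dots> \<le> (\<Sum>k<N. (x (Suc k) \<bullet> d - x k \<bullet> d) / N + 2 * e)"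
      by (intro sum_mono step) auto
    also have "\<dots> = (x N \<bullet> d - x 0 \<bullet> d) / N + N * (2 * e)"
      by (simp add: sum.distrib sum_lessThan_telescope[of "\<lambda>k. x k \<bullet> d"] flip: sum_divide_distrib)
    also have "N * (2 * e) = 2 / N" unfolding e_def using N by (simp add: power2_eq_square)
    also have "x N \<bullet> d - x 0 \<bullet> d \<le> B"
    proof -
      have "g1 b + h * (x N \<bullet> d) - e \<le> g1 (b + h *\<^sub>R d)"
        using x[of N "b + h *\<^sub>R d"] h by (simp add: yN)
      moreover have "g1 a - h * (x 0 \<bullet> d) - e \<le> g1 (a - h *\<^sub>R d)"
        using x[of 0 "a - h *\<^sub>R d"] h by (simp add: y0)
      ultimately have "h * (x N \<bullet> d - x 0 \<bullet> d)
          \<le> \<bar>g1 (b + h *\<^sub>R d)\<bar> + \<bar>g1 b\<bar> + \<bar>g1 (a - h *\<^sub>R d)\<bar> + \<bar>g1 a\<bar> + 2"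
        using N by (simp add: algebra_simps)
      then show ?thesis unfolding B_def using h by (simp add: field_simps)
    qed
    finally show ?thesis using N unfolding N_def by (simp add: add_divide_distrib divide_right_mono)
  qed
  have "(\<lambda>n. (B + 2) / real (Suc n)) \<longlonglongrightarrow> 0"
    by (rule LIMSEQ_Suc[OF lim_const_over_n])
  then have "g1 b - g1 a - (g2 b - g2 a) \<le> 0"
    by (rule LIMSEQ_le_const) (use bound in auto)
  then show ?thesis by simp
qed

section \<open>The convex support and dense sets of full measure\<close>

text \<open>The intersection that defines the convex support may be uncountable; Lindelof's theorem covers the
  complement by countably many of the null sets.\<close>

lemma AE_in_convex_msupport:
  fixes Q :: "'a::euclidean_space measure"
  assumes Q: "prob_space Q" and sQ: "sets Q = sets borel"
  shows "AE y in Q. y \<in> convex_msupport Q"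
proof -
  interpret prob_space Q by (rule Q)
  define F where "F = uminus ` {C. closed C \<and> convex C \<and> measure Q C = 1}"
  have "\<And>U. U \<in> F \<Longrightarrow> open U" unfolding F_def by auto
  then obtain F' where F': "F' \<subseteq> F" "countable F'" "\<Union>F' = \<Union>F" using Lindelof by metis
  have "AE y in Q. y \<notin> U" if U: "U \<in> F" for U
  proof -
    obtain C where C: "U = - C" "closed C" "measure Q C = 1" using U unfolding F_def by auto
    have "C \<in> sets Q" using C(2) sQ by auto
    then show ?thesis using C(1,3) by (auto simp: prob_eq_1)
  qed
  then have "AE y in Q. \<forall>U\<in>F'. y \<notin> U" using F' by (intro AE_ball_countable') auto
  then show ?thesis
  proof eventually_elim
    case (elim y)
    then have "y \<notin> \<Union>F" using F'(3) by auto
    then show ?case unfolding F_def convex_msupport_def by auto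
  qed
qed

lemma closed_convex_convex_msupport: "closed (convex_msupport Q)" "convex (convex_msupport Q)"
  unfolding convex_msupport_def by (auto intro!: closed_Inter convex_Inter)

lemma interior_msupport_subset: "interior (msupport Q) \<subseteq> interior (convex_msupport Q)"
  unfolding msupport_def convex_msupport_def by (intro interior_mono) auto

lemma AE_in_interior_convex_msupport:
  fixes Q :: "'a::euclidean_space measure"
  assumes Q: "prob_space Q" and sQ: "sets Q = sets borel"
    and f: "f \<in> borel_measurable borel" and Qf: "Q = density lborel f"
  shows "AE y in Q. y \<in> interior (convex_msupport Q)"
proof -
  have "negligible (frontier (convex_msupport Q))"
    by (intro negligible_convex_frontier closed_convex_convex_msupport)
  then have "frontier (convex_msupport Q) \<in> null_sets lborel"
    by (simp add: negligible_iff_null_sets null_sets_completion_iff)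
  then have "AE y in lborel. y \<notin> frontier (convex_msupport Q)" by (rule AE_not_in)
  then have "AE y in Q. y \<notin> frontier (convex_msupport Q)"
    unfolding Qf using f by (subst AE_density) auto
  with AE_in_convex_msupport[OF Q sQ] show ?thesis
  proof eventually_elim
    case (elim y)
    then show ?case using closed_convex_convex_msupport(1)[of Q] by (simp add: frontier_def)
  qed
qed

text \<open>A nonempty open subset of \<open>S\<close> has positive Lebesgue measure, hence positive measure for a density
  that is positive on \<open>S\<close>, so it cannot lie in the exceptional null set.\<close>

lemma AE_density_imp_dense:
  fixes f :: "'a::euclidean_space \<Rightarrow> ennreal"
  assumes f: "f \<in> borel_measurable borel" and S: "open S" and pos: "\<And>y. y \<in> S \<Longrightarrow> f y > 0"
    and ae: "AE y in density lborel f. R y"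
  shows "S \<subseteq> closure {y \<in> S. R y}"
proof
  fix y assume y: "y \<in> S"
  have ae': "AE y in lborel. 0 < f y \<longrightarrow> R y" using ae f by (subst (asm) AE_density) auto
  show "y \<in> closure {y \<in> S. R y}"
    unfolding closure_iff_nhds_not_empty
  proof (intro allI impI)
    fix A V assume V: "V \<subseteq> A" "open V" "y \<in> V"
    have "\<exists>z \<in> V \<inter> S. R z"
    proof (rule ccontr)
      assume no: "\<not> (\<exists>z \<in> V \<inter> S. R z)"
      have "AE z in lborel. z \<notin> V \<inter> S" using ae' by eventually_elim (use no pos in blast)
      then have "V \<inter> S \<in> null_sets lborel" using V S by (subst AE_iff_null_sets) auto
      then have "negligible (V \<inter> S)"
        by (simp add: negligible_iff_null_sets null_sets_completionI)
      then show False using open_not_negligible[of "V \<inter> S"] V S y by auto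
    qed
    then show "{y \<in> S. R y} \<inter> A \<noteq> {}" using V by auto
  qed
qed

lemma continuous_on_eq_on_closure_point:
  fixes h :: "'a::topological_space \<Rightarrow> 'b::t1_space"
  assumes "continuous_on S h" and "D \<subseteq> S" and "\<And>z. z \<in> D \<Longrightarrow> h z = c"
    and "y \<in> S" and "y \<in> closure D"
  shows "h y = c"
proof -
  have "closedin (top_of_set S) {z \<in> S. h z = c}"
    by (rule continuous_closedin_preimage_constant[OF assms(1)])
  then obtain T where T: "closed T" "{z \<in> S. h z = c} = S \<inter> T"
    by (auto simp: closedin_closed)
  have "D \<subseteq> T" using T(2) assms(2,3) by blast
  then have "closure D \<subseteq> T" using T(1) by (rule closure_minimal)
  then show ?thesis using T(2) assms(4,5) by blast
qed

section \<open>Uniqueness of the dual potential\<close>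

theorem corollary2p2:
  fixes P Q :: "(real ^ 'd) measure"
    and \<psi>1 \<psi>2 :: "real ^ 'd \<Rightarrow> ereal"
  assumes "prob_space P" and "sets P = sets borel"
    and "prob_space Q" and "sets Q = sets borel"
    and "integrable P (\<lambda>x. (norm x)\<^sup>2)"
    and "integrable Q (\<lambda>x. (norm x)\<^sup>2)"
    and "positive_density_in_convex_support Q"
    and "proper_fun \<psi>1" and "lsc_fun \<psi>1" and "convex_fun \<psi>1"
    and "proper_fun \<psi>2" and "lsc_fun \<psi>2" and "convex_fun \<psi>2"
    and "is_arg_min (dual_cost P Q) (\<lambda>p. p \<in> dual_feasible P Q) (convex_conj \<psi>1, \<psi>1)"
    and "is_arg_min (dual_cost P Q) (\<lambda>p. p \<in> dual_feasible P Q) (convex_conj \<psi>2, \<psi>2)"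
  shows "\<exists>C::real. (\<forall>y \<in> interior (msupport Q). \<psi>2 y = \<psi>1 y + ereal C) \<and>
                   (AE y in Q. \<psi>2 y = \<psi>1 y + ereal C)"
proof -
  interpret Q: prob_space Q by (rule assms(3))
  define \<phi>1 where "\<phi>1 = convex_conj \<psi>1"
  define \<phi>2 where "\<phi>2 = convex_conj \<psi>2"
  note min = assms(14,15)[folded \<phi>1_def \<phi>2_def]
  define S where "S = interior (convex_msupport Q)"
  have S: "open S" "convex S"
    unfolding S_def by (auto intro: convex_interior closed_convex_convex_msupport)
  obtain f where f: "f \<in> borel_measurable borel" "Q = density lborel f"
    "\<And>y. y \<in> S \<Longrightarrow> f y > 0"
    using assms(7) unfolding positive_density_in_convex_support_def S_def by auto
  have aeS: "AE y in Q. y \<in> S"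
    unfolding S_def by (rule AE_in_interior_convex_msupport[OF assms(3,4) f(1,2)])
  have dense: "S \<subseteq> closure {y \<in> S. R y}" if "AE y in Q. R y" for R
    using AE_density_imp_dense[OF f(1) S(1) f(3)] that[unfolded f(2)] by simp
  have feas: "(\<phi>1, \<psi>1) \<in> dual_feasible P Q" "(\<phi>2, \<psi>2) \<in> dual_feasible P Q"
    using min by (auto simp: is_arg_min_def)
  then have dom: "\<And>x y. ereal (x \<bullet> y) \<le> \<phi>1 x + \<psi>1 y" "\<And>x y. ereal (x \<bullet> y) \<le> \<phi>2 x + \<psi>2 y"
    and L1: "\<phi>1 \<in> L1_ext P" "\<phi>2 \<in> L1_ext P" "\<psi>1 \<in> L1_ext Q" "\<psi>2 \<in> L1_ext Q"
    unfolding dual_feasible_def by auto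
  have n: "\<And>x. \<phi>1 x \<noteq> - \<infinity>" "\<And>x. \<phi>2 x \<noteq> - \<infinity>" "\<And>x. \<psi>1 x \<noteq> - \<infinity>" "\<And>x. \<psi>2 x \<noteq> - \<infinity>"
    using L1 unfolding L1_ext_def by auto
  have fin: "\<psi>1 y \<noteq> \<infinity>" "\<psi>2 y \<noteq> \<infinity>" if "y \<in> S" for y
    using dense_convex_domain_imp_finite[OF assms(10) S(1) dense that]
      dense_convex_domain_imp_finite[OF assms(13) S(1) dense that] L1(3,4)
    by (simp_all add: L1_ext_def)
  define g1 where "g1 = (\<lambda>y. real_of_ereal (\<psi>1 y))"
  define g2 where "g2 = (\<lambda>y. real_of_ereal (\<psi>2 y))"
  have g: "\<psi>1 y = ereal (g1 y) \<and> \<psi>2 y = ereal (g2 y)" if "y \<in> S" for y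
    unfolding g1_def g2_def using fin[OF that] n(3,4)[of y] by (cases "\<psi>1 y"; cases "\<psi>2 y") simp_all
  have norm_int: "integrable Q norm"
  proof (rule Bochner_Integration.integrable_bound)
    show "integrable Q (\<lambda>y. 1 + (norm y)\<^sup>2)" using assms(6) by simp
    have "(\<lambda>y. y) \<in> borel_measurable Q" using assms(4) by (simp add: measurable_ident_sets)
    then show "norm \<in> borel_measurable Q" by measurable
    have "norm y \<le> 1 + (norm y)\<^sup>2" for y :: "real ^ 'd"
    proof -
      have "2 * norm y \<le> 1 + (norm y)\<^sup>2"
        using zero_le_power2[of "norm y - 1"] by (simp add: power2_diff)
      then show ?thesis using norm_ge_zero[of y] by linarith
    qed
    then show "AE y in Q. norm (norm y) \<le> norm (1 + (norm y)\<^sup>2)" by (intro AE_I2) simp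
  qed
  define c where "c = convex_conj (\<lambda>x. (\<phi>1 x + \<phi>2 x) / 2)"
  have proper_avg: "proper_fun (\<lambda>x. (\<phi>1 x + \<phi>2 x) / 2)"
    and ae: "AE y in Q. c y = (\<psi>1 y + \<psi>2 y) / 2"
    unfolding c_def using average_conj_eq_AE[OF assms(1,3,4) norm_int min] by auto
  have c_le: "c y \<le> (\<psi>1 y + \<psi>2 y) / 2" for y
    unfolding c_def using dom n by (intro convex_conj_average_le) auto
  have c_fin: "c y \<noteq> \<infinity>" if "y \<in> S" for y using c_le[of y] g[OF that] by auto
  have c_real: "c y = ereal (real_of_ereal (c y))" if "y \<in> S" for y
    using c_fin[OF that] convex_conj_not_MInfty[OF proper_avg, of y, folded c_def] by (cases "c y") simp_all
  have cont_real: "continuous_on S (\<lambda>y. real_of_ereal (h y))"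
    if h: "convex_fun h" and h_fin: "\<And>y. y \<in> S \<Longrightarrow> h y \<noteq> \<infinity>" for h :: "real ^ 'd \<Rightarrow> ereal"
    by (rule convex_on_continuous[OF S(1) convex_fun_imp_convex_on[OF h S(2) h_fin]])
  have c_convex: "convex_fun c" unfolding c_def by (rule convex_fun_convex_conj[OF proper_avg])
  have cont: "continuous_on S (\<lambda>y. real_of_ereal (c y))" "continuous_on S g1" "continuous_on S g2"
    unfolding g1_def g2_def
    using cont_real[OF c_convex c_fin] cont_real[OF assms(10) fin(1)] cont_real[OF assms(13) fin(2)]
    by simp_all
  have eqS: "c y = (\<psi>1 y + \<psi>2 y) / 2" if y: "y \<in> S" for y
  proof -
    let ?D = "{y \<in> S. c y = (\<psi>1 y + \<psi>2 y) / 2}"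
    define h where "h z = real_of_ereal (c z) - (g1 z + g2 z) / 2" for z
    have conth: "continuous_on S h"
      unfolding h_def using cont by (intro continuous_intros) auto
    have zero: "h z = 0" if z: "z \<in> ?D" for z
    proof -
      have "c z = ereal ((g1 z + g2 z) / 2)" using z g[of z] by simp
      then show ?thesis unfolding h_def by simp
    qed
    have "h y = 0"
    proof (rule continuous_on_eq_on_closure_point[where S = S and D = ?D])
      show "y \<in> closure ?D" using dense[OF ae] y by (rule subsetD)
    qed (use conth zero y in blast)+
    then have "real_of_ereal (c y) = (g1 y + g2 y) / 2" unfolding h_def by simp
    with c_real[OF y] have "c y = ereal ((g1 y + g2 y) / 2)" by metis
    then show ?thesis using g[OF y] by simp
  qed
  have sub: "\<exists>x. \<forall>z\<in>S. g1 y + x \<bullet> (z - y) - e \<le> g1 z \<and> g2 y + x \<bullet> (z - y) - e \<le> g2 z"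
    if "y \<in> S" "0 < e" for y e
    using common_approximate_subgradient[OF eqS[OF that(1), unfolded c_def] dom g n(1,2) that] .
  have const: "g2 b - g1 b = g2 a - g1 a" if "a \<in> S" "b \<in> S" for a b
    using common_subgradients_imp_increment_le[OF S sub that]
      common_subgradients_imp_increment_le[OF S sub that(2,1)] by linarith
  obtain C where C: "\<And>y. y \<in> S \<Longrightarrow> \<psi>2 y = \<psi>1 y + ereal C"
  proof (cases "S = {}")
    case False
    then obtain a where a: "a \<in> S" by blast
    show ?thesis
    proof (rule that[of "g2 a - g1 a"])
      fix y assume y: "y \<in> S"
      show "\<psi>2 y = \<psi>1 y + ereal (g2 a - g1 a)" using g[OF y] const[OF a y] by simp
    qed
  qed (use that in auto)
  show ?thesis
  proof (intro exI conjI ballI)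
    show "\<psi>2 y = \<psi>1 y + ereal C" if "y \<in> interior (msupport Q)" for y
      using C that interior_msupport_subset unfolding S_def by blast
    show "AE y in Q. \<psi>2 y = \<psi>1 y + ereal C" using aeS by eventually_elim (rule C)
  qed
qed

end
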